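(* Let the distribution of costs $\mathcal F$ be atomless and supported in $(0,1]$, and let $\bar B<\mathbb E_{c\sim\mathcal F}[c]$ be the average budget per agent. Consider the problem $$\begin{aligned}\inf_{A:[0,1]\to(0,1]}\ \sup_{x:[0,1]\to[0,1]}\ &\int_0^1\frac{x(c)}{A(c)}\,d\mathcal F(c)-\Big(\int_0^1 x(c)\,d\mathcal F(c)\Big)^2\\ \text{s.t. }&\int_0^1 c\cdot A(c)\,d\mathcal F(c)\le\bar B,\\ &A\text{ is monotone non-increasing}.\end{aligned}$$ Then the optimal allocation rule $A$ is determined by two constants $\bar A$ and $x^*\in\mathbb R$ such that $$A(c)=\begin{cases}\bar A&\text{if }c\le x^*,\\ \dfrac{\alpha}{\sqrt c}&\text{otherwise},\end{cases}$$ with $\alpha$ uniquely determined such that the budget constraint is binding; explicitly, $$\alpha=\frac{\bar B-\bar A\,\mathbb E[c\cdot1\{c\le x^*\}]}{\mathbb E[\sqrt c\cdot1\{c>x^*\}]}.$$ The quantities $\bar A$ and $x^*$ are defined as follows: for any $x>0$ let $$Q_\infty(x)=\mathbb E_{c\sim\mathcal F}[\min\{c,\sqrt{cx}\}],\qquad R_\infty(x)=2\,\mathbb E_{c\sim\mathcal F}\Big[\min\Big\{\frac cx,1\Big\}\Big],\qquad G(x)=\frac{Q_\infty(x)}{\max(1,R_\infty(x))}.$$ Then $$x^*=\min\{1,G^{-1}(\bar B)\}\qquad\text{and}\qquad \bar A=\frac{1}{\max(1,R_\infty(x^* ))}.$$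
   Context: This is the continuous-cost version of the analyst's problem of minimizing the worst-case variance of the Horvitz-Thompson (inverse-propensity-weighted) estimator of the mean of a $[0,1]$-valued moment function of the data: $A(c)$ is the probability of buying the data of an agent with cost $c$, $x(c)$ is the adversary's choice of the conditional probability that the moment equals $1$ given cost $c$, and $\bar B$ is the average budget per agent. All expectations are over $c\sim\mathcal F$. By convention, if $\bar B$ lies above the range of $G$, then $G^{-1}(\bar B)=+\infty$.
   Formalization: The printed Ā fails if B̄ > G(1) (e.g. costs uniform on [0.6,1], B̄=0.7: budget not binding, rule not optimal); there Ā = B̄/E[c] is proved instead. B̄ > 0 is assumed, α's uniqueness and formula are claimed only if E[√c·1{c>x*}] ≠ 0, and optimality is unique almost everywhere. *)

theory Defs
  imports "HOL-Probability.Probability"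
begin

text \<open>
  Costs are distributed according to a Borel probability measure \<open>F\<close> on the reals. Allocation
  rules and adversarial responses are functions on the whole real line of which only the
  values on \<open>{0..1}\<close> matter: the integrals below are set integrals over \<open>{0..1}\<close>.
\<close>

definition supported_in :: "real measure \<Rightarrow> real set \<Rightarrow> bool" where
  "supported_in F S \<longleftrightarrow> (AE c in F. c \<in> S)"

text \<open>For Borel measures on the real line, every atom contains a point of positive mass.\<close>

definition atomless :: "real measure \<Rightarrow> bool" where
  "atomless F \<longleftrightarrow> (\<forall>c. measure F {c} = 0)"

definition spending :: "real measure \<Rightarrow> (real \<Rightarrow> real) \<Rightarrow> real" where
  "spending F A = (LINT c:{0..1}|F. c * A c)"

definition feasible :: "real measure \<Rightarrow> real \<Rightarrow> (real \<Rightarrow> real) set" where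
  "feasible F B = {A. A \<in> {0..1} \<rightarrow> {0<..1} \<and> antimono_on {0..1} A \<and> spending F A \<le> B}"

definition responses :: "real measure \<Rightarrow> (real \<Rightarrow> real) set" where
  "responses F = {x. x \<in> {0..1} \<rightarrow> {0..1} \<and> set_borel_measurable F {0..1} x}"

text \<open>
  A feasible \<open>A\<close> is bounded below on \<open>{0..1}\<close> by \<open>A 1 > 0\<close>, so the integrand \<open>x c / A c\<close> is
  bounded and measurable for every response \<open>x\<close>, and no Bochner integral here takes its
  default value.
\<close>

definition objective :: "real measure \<Rightarrow> (real \<Rightarrow> real) \<Rightarrow> (real \<Rightarrow> real) \<Rightarrow> real" where
  "objective F A x = (LINT c:{0..1}|F. x c / A c) - (LINT c:{0..1}|F. x c)\<^sup>2"

definition worst_case :: "real measure \<Rightarrow> (real \<Rightarrow> real) \<Rightarrow> ereal" where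
  "worst_case F A = (SUP x\<in>responses F. ereal (objective F A x))"

definition optimal_allocation :: "real measure \<Rightarrow> real \<Rightarrow> (real \<Rightarrow> real) \<Rightarrow> bool" where
  "optimal_allocation F B A \<longleftrightarrow>
     A \<in> feasible F B \<and> worst_case F A = (INF A'\<in>feasible F B. worst_case F A')"

definition Q_inf :: "real measure \<Rightarrow> real \<Rightarrow> real" where
  "Q_inf F x = (\<integral>c. min c (sqrt (c * x)) \<partial>F)"

definition R_inf :: "real measure \<Rightarrow> real \<Rightarrow> real" where
  "R_inf F x = 2 * (\<integral>c. min (c / x) 1 \<partial>F)"

definition G :: "real measure \<Rightarrow> real \<Rightarrow> real" where
  "G F x = Q_inf F x / max 1 (R_inf F x)"

text \<open>The inverse of \<open>G\<close> on \<open>{0<..}\<close>, set to infinity above the range of \<open>G\<close>.\<close>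

definition G_inv :: "real measure \<Rightarrow> real \<Rightarrow> ereal" where
  "G_inv F B =
     (if \<forall>x>0. G F x < B then \<infinity> else ereal (THE x. 0 < x \<and> G F x = B))"

definition x_star :: "real measure \<Rightarrow> real \<Rightarrow> real" where
  "x_star F B = real_of_ereal (min 1 (G_inv F B))"

definition threshold_rule :: "real \<Rightarrow> real \<Rightarrow> real \<Rightarrow> real \<Rightarrow> real" where
  "threshold_rule Ab xs \<alpha> c = (if c \<le> xs then Ab else \<alpha> / sqrt c)"

end

theory Submission
  imports Defs
begin

text \<open>
  Let \<open>q\<close> be the unique root of \<open>G F q = B\<close>, which may exceed \<open>1\<close>, and let \<open>M = max 1 (R_inf F q)\<close>.
  The allocation \<open>s c = min 1 (sqrt (q / c)) / M\<close> spends exactly \<open>G F q = B\<close> and agrees on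
  \<open>{0<..1}\<close> with the threshold rule cut at \<open>min 1 q\<close>. It forms a saddle point with a response \<open>w\<close>
  that mixes \<open>min 1 (c / q)\<close> with the constant \<open>1\<close> so as to have mean \<open>M / 2\<close>: the first-order
  condition of the adversary, concave in the response, is \<open>1 / s c = 2 (M / 2)\<close> where \<open>c \<le> q\<close>, and
  \<open>1 / s c \<ge> M\<close> with \<open>w c = 1\<close> elsewhere. Against \<open>w\<close> the variance is strictly convex in the
  allocation and \<open>s\<close> satisfies the Karush-Kuhn-Tucker conditions for the budget with multiplier
  \<open>M\<^sup>2 / q\<close>, so \<open>s\<close> is the almost everywhere unique minimizer.
\<close>

section \<open>Measurability on a set\<close>

lemma set_borel_measurable_antimono_on:
  fixes f :: "real \<Rightarrow> real"
  assumes "antimono_on S f" "S \<in> sets borel"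
  shows "set_borel_measurable borel S f"
proof -
  have "mono_on S (\<lambda>c. - f c)"
    using assms(1) by (auto simp: monotone_on_def)
  then have "(\<lambda>c. - (- f c)) \<in> borel_measurable (restrict_space borel S)"
    by (intro borel_measurable_uminus borel_measurable_mono_on_fnc)
  then show ?thesis
    using assms(2) by (simp add: borel_measurable_restrict_space_iff set_borel_measurable_def)
qed

lemma set_borel_measurable_divide:
  fixes f g :: "'a \<Rightarrow> real"
  assumes "set_borel_measurable M S f" "set_borel_measurable M S g"
  shows "set_borel_measurable M S (\<lambda>c. f c / g c)"
proof -
  have "(\<lambda>c. (indicator S c *\<^sub>R f c) / (indicator S c *\<^sub>R g c)) \<in> borel_measurable M"
    using assms unfolding set_borel_measurable_def by measurable
  also have "(\<lambda>c. (indicator S c *\<^sub>R f c) / (indicator S c *\<^sub>R g c))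
    = (\<lambda>c. indicator S c *\<^sub>R (f c / g c))"
    by (auto simp: indicator_def)
  finally show ?thesis
    unfolding set_borel_measurable_def .
qed

lemma set_borel_measurable_times:
  fixes f g :: "'a \<Rightarrow> real"
  assumes "set_borel_measurable M S f" "set_borel_measurable M S g"
  shows "set_borel_measurable M S (\<lambda>c. f c * g c)"
proof -
  have "(\<lambda>c. (indicator S c *\<^sub>R f c) * (indicator S c *\<^sub>R g c)) \<in> borel_measurable M"
    using assms unfolding set_borel_measurable_def by measurable
  also have "(\<lambda>c. (indicator S c *\<^sub>R f c) * (indicator S c *\<^sub>R g c))
    = (\<lambda>c. indicator S c *\<^sub>R (f c * g c))"
    by (auto simp: indicator_def)
  finally show ?thesis
    unfolding set_borel_measurable_def .
qed

section \<open>Integration against a cost distribution\<close>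

locale cost_distribution = real_distribution F for F :: "real measure" +
  assumes supp: "supported_in F {0<..1}"
begin

lemma AE_cost: "AE c in F. 0 < c \<and> c \<le> 1"
  using supp by (simp add: supported_in_def)

lemma prob_UNIV: "prob UNIV = 1"
  using prob_space by simp

lemma set_integrable_bounded:
  fixes f :: "real \<Rightarrow> real"
  assumes "set_borel_measurable F {0..1} f" "\<And>c. c \<in> {0..1} \<Longrightarrow> \<bar>f c\<bar> \<le> K"
  shows "set_integrable F {0..1} f"
  unfolding set_integrable_def
proof (rule integrable_const_bound)
  \<comment> \<open>The absolute value keeps the bound nonnegative outside \<open>{0..1}\<close>,
    where the integrand is 0, with no case split on the sign of \<open>K\<close>.\<close>
  show "AE c in F. norm (indicator {0..1} c *\<^sub>R f c) \<le> \<bar>K\<bar>"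
    using assms(2) by (intro AE_I2) (auto simp: indicator_def intro: order_trans[OF _ abs_ge_self])
qed (use assms(1) in \<open>simp add: set_borel_measurable_def\<close>)

lemma set_borel_measurable_borel:
  fixes f :: "real \<Rightarrow> real"
  assumes [measurable]: "f \<in> borel_measurable borel"
  shows "set_borel_measurable F {0..1} f"
  unfolding set_borel_measurable_def by measurable

text \<open>\<open>Q_inf\<close> and \<open>R_inf\<close> integrate over the whole line,
  \<open>spending\<close> and \<open>objective\<close> over \<open>{0..1}\<close>; the support of
  \<open>F\<close> reconciles the two.\<close>

lemma integral_eq_set_integral:
  fixes f :: "real \<Rightarrow> real"
  assumes [measurable]: "f \<in> borel_measurable borel"
  shows "(\<integral>c. f c \<partial>F) = (LINT c:{0..1}|F. f c)"
  unfolding set_lebesgue_integral_def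
proof (rule integral_cong_AE)
  show "AE c in F. f c = indicator {0..1} c *\<^sub>R f c"
    using AE_cost by eventually_elim (auto simp: indicator_def)
qed measurable

lemma integrable_bounded:
  fixes f :: "real \<Rightarrow> real"
  assumes [measurable]: "f \<in> borel_measurable borel" and "\<And>c. 0 < c \<Longrightarrow> c \<le> 1 \<Longrightarrow> \<bar>f c\<bar> \<le> K"
  shows "integrable F f"
proof (rule integrable_const_bound)
  show "AE c in F. norm (f c) \<le> K"
    using AE_cost by eventually_elim (auto intro: assms(2))
qed measurable

lemma integral_mono_cost:
  fixes f g :: "real \<Rightarrow> real"
  assumes "integrable F f" "integrable F g"
    and "\<And>c. 0 < c \<Longrightarrow> c \<le> 1 \<Longrightarrow> f c \<le> g c"
  shows "(\<integral>c. f c \<partial>F) \<le> (\<integral>c. g c \<partial>F)"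
proof (rule integral_mono_AE)
  show "AE c in F. f c \<le> g c"
    using AE_cost by eventually_elim (auto intro: assms(3))
qed (use assms in auto)

lemma integrable_cost: "integrable F (\<lambda>c. c)"
  by (rule integrable_bounded[of _ 1]) auto

lemma integrable_Q: "0 < x \<Longrightarrow> integrable F (\<lambda>c. min c (sqrt (c * x)))"
  by (rule integrable_bounded[of _ 1]) (auto simp: min_le_iff_disj)

lemma integrable_R: "0 < x \<Longrightarrow> integrable F (\<lambda>c. min (c / x) 1)"
  by (rule integrable_bounded[of _ 1]) (auto simp: min_le_iff_disj)

section \<open>Monotonicity of Q, R and G\<close>

lemma Q_mono:
  assumes "0 < x" "x \<le> y"
  shows "Q_inf F x \<le> Q_inf F y"
  unfolding Q_inf_def using assms
  by (intro integral_mono_cost integrable_Q) (auto simp: min_le_iff_disj)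

lemma Q_nonneg: "0 < x \<Longrightarrow> 0 \<le> Q_inf F x"
  unfolding Q_inf_def
  by (rule integral_nonneg_AE) (use AE_cost in \<open>eventually_elim, auto\<close>)

lemma R_antimono:
  assumes "0 < x" "x \<le> y"
  shows "R_inf F y \<le> R_inf F x"
  unfolding R_inf_def using assms
  by (intro mult_left_mono integral_mono_cost integrable_R) (auto simp: min_le_iff_disj frac_le)

lemma R_le:
  assumes "0 < x"
  shows "R_inf F x \<le> 2 * (\<integral>c. c \<partial>F) / x"
proof -
  have "(\<integral>c. min (c / x) 1 \<partial>F) \<le> (\<integral>c. c / x \<partial>F)"
    using assms by (intro integral_mono_cost integrable_R integrable_divide integrable_cost) auto
  then show ?thesis
    by (simp add: R_inf_def)
qed

lemma R_le_2:
  assumes "0 < x"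
  shows "R_inf F x \<le> 2"
proof -
  have "(\<integral>c. min (c / x) 1 \<partial>F) \<le> (\<integral>c. 1 \<partial>F)"
    using assms by (intro integral_mono_cost integrable_R) auto
  then show ?thesis
    by (simp add: R_inf_def prob_UNIV)
qed

lemma Q_eq_mean:
  assumes "0 < x" "AE c in F. c \<le> x"
  shows "Q_inf F x = (\<integral>c. c \<partial>F)"
  unfolding Q_inf_def
proof (rule integral_cong_AE)
  show "AE c in F. min c (sqrt (c * x)) = c"
    using AE_cost assms(2)
  proof eventually_elim
    case (elim c)
    then have "c \<le> sqrt (c * x)"
      by (intro real_le_rsqrt) (simp add: power2_eq_square)
    then show ?case by simp
  qed
qed measurable

lemma R_eq_mean:
  assumes "0 < x" "AE c in F. c \<le> x"
  shows "R_inf F x = 2 * (\<integral>c. c \<partial>F) / x"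
proof -
  have "(\<integral>c. min (c / x) 1 \<partial>F) = (\<integral>c. c / x \<partial>F)"
  proof (rule integral_cong_AE)
    show "AE c in F. min (c / x) 1 = c / x"
      using assms(2) by eventually_elim (use assms(1) in auto)
  qed measurable
  then show ?thesis
    by (simp add: R_inf_def)
qed

text \<open>At a cost \<open>c > x\<close> the minimum is \<open>sqrt (c * x) < c\<close>, so
  raising \<open>x\<close> to \<open>y\<close> strictly raises the integrand. Equal integrals
  therefore leave almost no cost above \<open>x\<close>.\<close>

lemma AE_le_if_Q_eq:
  assumes "0 < x" "x < y" "Q_inf F x = Q_inf F y"
  shows "AE c in F. c \<le> x"
proof -
  let ?d = "\<lambda>c. min c (sqrt (c * y)) - min c (sqrt (c * x))"
  have "AE c in F. 0 \<le> ?d c"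
    using AE_cost
  proof eventually_elim
    case (elim c)
    have "sqrt (c * x) \<le> sqrt (c * y)"
      using elim assms by (auto intro!: mult_left_mono)
    then show ?case by linarith
  qed
  moreover have "integrable F ?d"
    using assms by (intro Bochner_Integration.integrable_diff integrable_Q) auto
  moreover have "(\<integral>c. ?d c \<partial>F) = 0"
    using assms by (simp add: Bochner_Integration.integral_diff integrable_Q Q_inf_def)
  ultimately have "AE c in F. ?d c = 0"
    using integral_nonneg_eq_0_iff_AE by blast
  then show ?thesis
    using AE_cost
  proof eventually_elim
    case (elim c)
    show ?case
    proof (rule ccontr)
      assume "\<not> c \<le> x"
      then have "c * x < c * c" "c * x < c * y"
        using elim assms by auto
      then have "sqrt (c * x) < sqrt (c * c)" "sqrt (c * x) < sqrt (c * y)"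
        using real_sqrt_less_mono by blast+
      then show False
        using elim by (simp add: min_def split: if_splits)
    qed
  qed
qed

lemma G_mono:
  assumes "0 < x" "x \<le> y"
  shows "G F x \<le> G F y"
  unfolding G_def using Q_mono[OF assms] R_antimono[OF assms] Q_nonneg[of x] assms
  by (intro frac_le) auto

text \<open>If the numerator does not grow, almost all costs are at most \<open>x\<close> and it
  already equals the mean. As \<open>G F x\<close> is below the mean, the denominator exceeds 1; it
  is then twice the mean over \<open>x\<close>, which strictly decreases.\<close>

lemma G_strict_mono:
  assumes "0 < x" "x < y" "G F x < (\<integral>c. c \<partial>F)"
  shows "G F x < G F y"
proof (cases "Q_inf F x = Q_inf F y")
  case False
  then show ?thesis
    unfolding G_def using Q_mono[of x y] R_antimono[of x y] Q_nonneg[of x] assms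
    by (intro frac_less) auto
next
  case True
  let ?\<mu> = "\<integral>c. c \<partial>F"
  have AE: "AE c in F. c \<le> x"
    using AE_le_if_Q_eq assms True by blast
  have Q: "Q_inf F x = ?\<mu>" and R: "R_inf F x = 2 * ?\<mu> / x"
    using Q_eq_mean R_eq_mean AE assms by auto
  have "0 \<le> G F x"
    unfolding G_def using Q_nonneg assms by simp
  then have \<mu>: "0 < ?\<mu>"
    using assms by simp
  have "1 < R_inf F x"
    using assms(3) by (cases "R_inf F x \<le> 1") (auto simp: G_def Q max_absorb1)
  moreover have "R_inf F y \<le> 2 * ?\<mu> / y"
    using R_le assms by simp
  moreover have "2 * ?\<mu> / y < 2 * ?\<mu> / x"
    using assms \<mu> by (intro divide_strict_left_mono) auto
  ultimately have "max 1 (R_inf F y) < max 1 (R_inf F x)"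
    using R by linarith
  then show ?thesis
    unfolding G_def True[symmetric] Q using \<mu> by (intro divide_strict_left_mono) auto
qed

section \<open>Continuity of G and its unique root\<close>

lemma continuous_on_integral_cost:
  fixes f :: "real \<Rightarrow> real \<Rightarrow> real"
  assumes meas: "\<And>x. f x \<in> borel_measurable borel"
    and bound: "\<And>x c. x \<in> S \<Longrightarrow> 0 < c \<Longrightarrow> c \<le> 1 \<Longrightarrow> \<bar>f x c\<bar> \<le> K"
    and cont: "\<And>c. 0 < c \<Longrightarrow> c \<le> 1 \<Longrightarrow> continuous_on S (\<lambda>x. f x c)"
  shows "continuous_on S (\<lambda>x. \<integral>c. f x c \<partial>F)"
  unfolding continuous_on_sequentially
proof (intro allI ballI impI; elim conjE)
  fix u a assume a: "a \<in> S" and u: "\<forall>n. u n \<in> S" "u \<longlonglongrightarrow> a"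
  show "((\<lambda>x. \<integral>c. f x c \<partial>F) \<circ> u) \<longlonglongrightarrow> (\<integral>c. f a c \<partial>F)"
    unfolding comp_def
  proof (rule integral_dominated_convergence[where w = "\<lambda>_. K"])
    show "AE c in F. (\<lambda>n. f (u n) c) \<longlonglongrightarrow> f a c"
      using AE_cost
    proof eventually_elim
      case (elim c)
      then show ?case
        using cont[of c] a u unfolding continuous_on_sequentially comp_def by blast
    qed
    show "AE c in F. norm (f (u n) c) \<le> K" for n
      using AE_cost by eventually_elim (use bound u in auto)
  qed (use meas in \<open>simp_all cong: measurable_cong_sets\<close>)
qed

lemma continuous_on_G: "continuous_on {0<..} (G F)"
proof -
  have "continuous_on {0<..} (Q_inf F)"
    unfolding Q_inf_def
    by (rule continuous_on_integral_cost[where K = 1]) (auto intro!: continuous_intros simp: min_le_iff_disj)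
  moreover have "continuous_on {0<..} (R_inf F)"
    unfolding R_inf_def
    by (intro continuous_on_mult continuous_on_const continuous_on_integral_cost[where K = 1])
      (auto intro!: continuous_intros simp: min_le_iff_disj)
  ultimately show ?thesis
    unfolding G_def [abs_def] by (intro continuous_intros) auto
qed

lemma mean_le_1: "(\<integral>c. c \<partial>F) \<le> 1"
proof -
  have "(\<integral>c. c \<partial>F) \<le> (\<integral>c. 1 \<partial>F)"
    using integrable_cost by (intro integral_mono_cost) auto
  then show ?thesis by (simp add: prob_UNIV)
qed

lemma ex1_G_eq:
  assumes "0 < B" "B < (\<integral>c. c \<partial>F)"
  shows "\<exists>!x. 0 < x \<and> G F x = B"
proof -
  have "B < 1"
    using assms mean_le_1 by linarith
  \<comment> \<open>Left endpoint for the intermediate value theorem: costs are at most 1, so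
    \<open>sqrt (c * x)\<close> stays below \<open>B\<close> when \<open>x\<close> is the square of
    \<open>B\<close>.\<close>
  have "G F (B\<^sup>2) \<le> Q_inf F (B\<^sup>2)"
    unfolding G_def using Q_nonneg[of "B\<^sup>2"] assms by (simp add: divide_le_eq mult_le_cancel_left1)
  also have "Q_inf F (B\<^sup>2) \<le> (\<integral>c. B \<partial>F)"
    unfolding Q_inf_def
  proof (intro integral_mono_cost integrable_Q)
    fix c :: real assume c: "0 < c" "c \<le> 1"
    have "sqrt (c * B\<^sup>2) = sqrt c * B"
      using assms by (simp add: real_sqrt_mult)
    also have "\<dots> \<le> B"
      using c assms by (simp add: mult_le_cancel_right1)
    finally show "min c (sqrt (c * B\<^sup>2)) \<le> B" by simp
  qed (use assms in auto)
  finally have lower: "G F (B\<^sup>2) \<le> B"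
    by (simp add: prob_UNIV)
  have AE: "AE c in F. c \<le> 2"
    using AE_cost by eventually_elim auto
  \<comment> \<open>Right endpoint: 2 exceeds all costs, and \<open>R_inf F 2\<close> is the mean,
    hence at most 1, so the denominator of \<open>G\<close> is 1.\<close>
  have "G F 2 = (\<integral>c. c \<partial>F)"
    unfolding G_def Q_eq_mean[OF _ AE, simplified] R_eq_mean[OF _ AE, simplified]
    using mean_le_1 by (simp add: max_def)
  then have upper: "B \<le> G F 2"
    using assms by simp
  have "B\<^sup>2 \<le> 2"
    using \<open>B < 1\<close> assms by (simp add: power_le_one order_trans[of _ 1])
  moreover have "continuous_on {B\<^sup>2..2} (G F)"
    by (rule continuous_on_subset[OF continuous_on_G]) (use assms in \<open>auto intro: less_le_trans[of _ "B\<^sup>2"]\<close>)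
  ultimately obtain x where x: "B\<^sup>2 \<le> x" "G F x = B"
    using IVT'[of "G F", OF lower upper] by auto
  show ?thesis
  proof (rule ex1I[of _ x])
    show "0 < x \<and> G F x = B"
      using x assms by (auto intro: less_le_trans[of _ "B\<^sup>2"])
    show "y = x" if "0 < y \<and> G F y = B" for y
      using G_strict_mono[of x y] G_strict_mono[of y x] that x assms \<open>0 < x \<and> G F x = B\<close>
      by (cases x y rule: linorder_cases) auto
  qed
qed

section \<open>Threshold rules: spending and a tangent bound\<close>

lemma spending_threshold_rule:
  assumes "0 \<le> xs"
  shows "spending F (threshold_rule a xs \<alpha>)
    = a * (\<integral>c. c * indicator {..xs} c \<partial>F) + \<alpha> * (\<integral>c. sqrt c * indicator {xs<..} c \<partial>F)"
proof -
  have "(LINT c:{0..1}|F. c * threshold_rule a xs \<alpha> c)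
    = (LINT c:{0..1}|F. a * (c * indicator {..xs} c) + \<alpha> * (sqrt c * indicator {xs<..} c))"
    using assms unfolding set_lebesgue_integral_def
    by (intro Bochner_Integration.integral_cong refl)
      (auto simp: threshold_rule_def indicator_def field_simps)
  also have "\<dots> = (LINT c:{0..1}|F. a * (c * indicator {..xs} c))
      + (LINT c:{0..1}|F. \<alpha> * (sqrt c * indicator {xs<..} c))"
    by (intro set_integral_add(2) set_integrable_mult_right set_integrable_bounded[of _ 1]
        set_borel_measurable_borel) (auto simp: indicator_def)
  finally show ?thesis
    by (simp add: spending_def integral_eq_set_integral)
qed

end

text \<open>
  This is the tangent bound for \<open>w / a\<close> at \<open>a = s\<close> with its exact quadratic remainder. The slope
  \<open>w / s\<^sup>2\<close> equals \<open>(M\<^sup>2 / q) c\<close>, the budget multiplier times the cost, except where the cap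
  \<open>a \<le> 1\<close> binds; there it is larger, but \<open>s - a \<ge> 0\<close>.
\<close>

lemma allocation_tangent:
  fixes a c q t M :: real
  defines "w \<equiv> (1 - t) * min (c / q) 1 + t"
    and "s \<equiv> threshold_rule (1 / M) q (sqrt q / M) c"
  assumes "0 < q" "0 \<le> c" "0 < a" "a \<le> 1" "1 \<le> M" "0 \<le> t" "t \<le> 1" "M = 1 \<or> t = 0"
  shows "M\<^sup>2 / q * (c * s - c * a) + w * (a - s)\<^sup>2 / (a * s\<^sup>2) \<le> w / a - w / s"
proof -
  have "0 < s"
    using assms by (auto simp: s_def threshold_rule_def)
  have "M\<^sup>2 / q * c * (s - a) \<le> w / s\<^sup>2 * (s - a)"
  proof (cases "c \<le> q")
    case False
    then have "w / s\<^sup>2 = M\<^sup>2 / q * c"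
      using assms by (simp add: w_def s_def threshold_rule_def power_divide min_def field_simps)
    then show ?thesis by simp
  next
    case True
    then have s: "s = 1 / M" and w: "w = (1 - t) * (c / q) + t"
      using assms by (auto simp: w_def s_def threshold_rule_def min_def)
    show ?thesis
    proof (cases "t = 0")
      case True
      then show ?thesis
        by (simp add: s w power_divide mult_ac)
    next
      case False
      then have "M = 1" using assms by simp
      \<comment> \<open>This is the excess of \<open>w\<close> over \<open>c / q\<close>; it has the
        right sign because it gets multiplied by \<open>s - a = 1 - a\<close>.\<close>
      have "0 \<le> t * (1 - c / q)"
        using \<open>c \<le> q\<close> \<open>0 < q\<close> \<open>0 \<le> t\<close> by simp
      then have "c / q \<le> w"
        unfolding w left_diff_distrib right_diff_distrib by linarith
      then have "c / q * (1 - a) \<le> w * (1 - a)"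
        using assms by (intro mult_right_mono) auto
      then show ?thesis
        by (simp add: s \<open>M = 1\<close>)
    qed
  qed
  moreover have "w / a - w / s = w / s\<^sup>2 * (s - a) + w * (a - s)\<^sup>2 / (a * s\<^sup>2)"
    using \<open>0 < s\<close> \<open>0 < a\<close> by (simp add: field_simps power2_eq_square)
  ultimately show ?thesis
    by (simp add: algebra_simps)
qed

section \<open>The candidate saddle point\<close>

locale saddle = cost_distribution +
  fixes q :: real
  assumes q_pos: "0 < q"
begin

definition M where "M = max 1 (R_inf F q)"

text \<open>The factor \<open>sqrt q / M\<close> makes both branches equal \<open>1 / M\<close> at
  \<open>q\<close>, which keeps the rule monotone. The cut is at \<open>q\<close> even when
  \<open>q > 1\<close>, so that one formula serves both cases.\<close>

definition s where "s = threshold_rule (1 / M) q (sqrt q / M)"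

text \<open>
  The mixing weight is chosen so that \<open>w\<close> has mean \<open>M / 2\<close>, which makes the adversary indifferent
  wherever \<open>s = 1 / M\<close>. At \<open>R_inf F q = 2\<close> it is \<open>0 / 0 = 0\<close>, the weight for \<open>R_inf F q \<ge> 1\<close>.
\<close>

definition t where "t = (M - R_inf F q) / (2 - R_inf F q)"

definition w where "w c = (1 - t) * min (c / q) 1 + t"

lemma M_ge_1: "1 \<le> M"
  by (simp add: M_def)

text \<open>If \<open>R_inf F q <= 1\<close>, then \<open>M = 1\<close> and the numerator of
  \<open>t\<close> is smaller than its denominator; otherwise \<open>M = R_inf F q\<close> and the
  numerator vanishes.\<close>

lemma t_bounds: "0 \<le> t" "t < 1" "M = 1 \<or> t = 0"
  using R_le_2[OF q_pos] by (auto simp: t_def M_def max_def divide_less_eq)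

lemma w_bounds:
  assumes "0 \<le> c"
  shows "0 \<le> w c" "w c \<le> 1"
proof -
  show "0 \<le> w c"
    using assms t_bounds q_pos by (auto simp: w_def intro!: add_nonneg_nonneg mult_nonneg_nonneg)
  have "(1 - t) * min (c / q) 1 \<le> (1 - t) * 1"
    using t_bounds by (intro mult_left_mono) auto
  then show "w c \<le> 1" by (simp add: w_def)
qed

lemma w_pos: "0 < c \<Longrightarrow> 0 < w c"
  using t_bounds q_pos by (auto simp: w_def intro!: add_pos_nonneg)

lemma w_eq_1: "q < c \<Longrightarrow> w c = 1"
  using q_pos by (simp add: w_def min_def)

lemma borel_measurable_w: "w \<in> borel_measurable borel"
  unfolding w_def[abs_def] by measurable

lemma w_response: "w \<in> responses F"
  using w_bounds set_borel_measurable_borel[OF borel_measurable_w] by (auto simp: responses_def)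

lemma integral_w: "(LINT c:{0..1}|F. w c) = M / 2"
proof -
  have "(LINT c:{0..1}|F. w c) = (\<integral>c. (1 - t) * min (c / q) 1 + t \<partial>F)"
    using integral_eq_set_integral[OF borel_measurable_w] by (simp add: w_def)
  also have "\<dots> = (1 - t) * (R_inf F q / 2) + t"
    using integrable_R[OF q_pos] by (simp add: R_inf_def prob_UNIV)
  also have "\<dots> = R_inf F q / 2 + t * (2 - R_inf F q) / 2"
    by (simp add: field_simps)
  \<comment> \<open>For \<open>R_inf F q = 2\<close> also \<open>M = 2\<close>, so both sides are 0
    and the default value of the division is harmless.\<close>
  also have "t * (2 - R_inf F q) = M - R_inf F q"
    using R_le_2[OF q_pos] by (auto simp: t_def M_def)
  also have "R_inf F q / 2 + (M - R_inf F q) / 2 = M / 2"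
    by (simp add: diff_divide_distrib)
  finally show ?thesis .
qed

lemma s_le: "0 \<le> c \<Longrightarrow> s c \<le> 1 / M"
  using M_ge_1 q_pos by (auto simp: s_def threshold_rule_def field_simps)

lemma s_pos: "0 \<le> c \<Longrightarrow> 0 < s c"
  using M_ge_1 q_pos by (auto simp: s_def threshold_rule_def)

lemma s_antimono: "antimono_on {0..1} s"
  using M_ge_1 q_pos by (auto simp: monotone_on_def s_def threshold_rule_def field_simps)

lemma s_range: "s \<in> {0..1} \<rightarrow> {0<..1}"
proof
  fix c :: real assume "c \<in> {0..1}"
  then have "0 < s c" "s c \<le> 1 / M"
    using s_pos s_le by auto
  moreover have "1 / M \<le> 1"
    using M_ge_1 by simp
  ultimately show "s c \<in> {0<..1}"
    by simp
qed

text \<open>Multiplying the allocation by the cost turns it into the integrand of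
  \<open>Q_inf\<close>, divided by \<open>M\<close>.\<close>

lemma spending_s: "spending F s = G F q"
proof -
  have "c * s c = min c (sqrt (c * q)) / M" if "c \<in> {0..1}" for c
  proof (cases "c \<le> q")
    case True
    then have "c \<le> sqrt (c * q)"
      using that by (intro real_le_rsqrt) (auto simp: power2_eq_square intro: mult_left_mono)
    then show ?thesis
      using True by (simp add: s_def threshold_rule_def)
  next
    case False
    then have "sqrt (c * q) \<le> c"
      using that q_pos by (intro real_le_lsqrt) (auto simp: power2_eq_square intro: mult_left_mono)
    moreover have "c * (sqrt q / sqrt c) = sqrt (c * q)"
      using False q_pos by (simp add: real_sqrt_mult field_simps)
    moreover have "c * s c = c * (sqrt q / sqrt c) / M"
      using False by (simp add: s_def threshold_rule_def)
    ultimately show ?thesis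
      by (simp only: min_absorb2)
  qed
  then have "spending F s = (LINT c:{0..1}|F. min c (sqrt (c * q)) / M)"
    unfolding spending_def set_lebesgue_integral_def
    by (intro Bochner_Integration.integral_cong refl) (auto simp: indicator_def)
  also have "\<dots> = (\<integral>c. min c (sqrt (c * q)) / M \<partial>F)"
    by (intro integral_eq_set_integral[symmetric]) measurable
  finally show ?thesis
    by (simp add: G_def Q_inf_def M_def)
qed

section \<open>Feasibility and integrability\<close>

lemma s_feasible: "s \<in> feasible F (G F q)"
  using s_range s_antimono spending_s by (simp add: feasible_def)

lemma set_integrable_response: "x \<in> responses F \<Longrightarrow> set_integrable F {0..1} x"
  by (rule set_integrable_bounded[of _ 1]) (auto simp: responses_def Pi_iff)

text \<open>Feasibility does not ask for measurability; monotonicity supplies it.\<close>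

lemma set_borel_measurable_allocation:
  "A \<in> feasible F B \<Longrightarrow> set_borel_measurable F {0..1} A"
  using set_borel_measurable_antimono_on[of "{0..1}" A]
  by (simp add: feasible_def set_borel_measurable_def cong: measurable_cong_sets)

lemma set_integrable_response_div:
  assumes "x \<in> responses F" "A \<in> feasible F B"
  shows "set_integrable F {0..1} (\<lambda>c. x c / A c)"
proof (rule set_integrable_bounded[of _ "1 / A 1"])
  show "set_borel_measurable F {0..1} (\<lambda>c. x c / A c)"
    using assms set_borel_measurable_allocation
    by (intro set_borel_measurable_divide) (auto simp: responses_def)
  fix c :: real assume c: "c \<in> {0..1}"
  have "0 < A 1" "A 1 \<le> A c" "0 \<le> x c" "x c \<le> 1"
    using assms c by (auto simp: feasible_def responses_def monotone_on_def Pi_iff)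
  then show "\<bar>x c / A c\<bar> \<le> 1 / A 1"
    by (simp add: frac_le)
qed

lemma set_integrable_cost_allocation:
  assumes "A \<in> feasible F B"
  shows "set_integrable F {0..1} (\<lambda>c. c * A c)"
proof (rule set_integrable_bounded[of _ 1])
  show "set_borel_measurable F {0..1} (\<lambda>c. c * A c)"
    using assms by (intro set_borel_measurable_times set_borel_measurable_allocation
        set_borel_measurable_borel) auto
  fix c :: real assume c: "c \<in> {0..1}"
  have "0 < A c" "A c \<le> 1"
    using assms c by (auto simp: feasible_def Pi_iff)
  then show "\<bar>c * A c\<bar> \<le> 1"
    using c by (simp add: abs_mult mult_le_one)
qed

section \<open>Optimality of both sides of the saddle point\<close>

text \<open>With \<open>M / 2\<close> the mean of \<open>w\<close>, the gain from \<open>w\<close>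
  to \<open>x\<close> is the integral of \<open>(x c - w c) * (1 / s c - M)\<close> minus the square
  of the difference of means. The integrand is never positive: its second factor vanishes up to
  \<open>q\<close>, and beyond \<open>q\<close> the response \<open>w\<close> is already
  maximal.\<close>

lemma w_best_response:
  assumes x: "x \<in> responses F"
  shows "objective F s x \<le> objective F s w"
proof -
  let ?I = "\<lambda>f. LINT c:{0..1}|F. f c"
  note int = set_integrable_response_div[OF _ s_feasible] set_integrable_response
  have "?I (\<lambda>c. x c / s c - w c / s c) \<le> ?I (\<lambda>c. M * (x c - w c))"
  proof (intro set_integral_mono set_integral_diff(1) set_integrable_mult_right int x w_response)
    fix c :: real assume c: "c \<in> {0..1}"
    show "x c / s c - w c / s c \<le> M * (x c - w c)"
    proof (cases "c \<le> q")
      case True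
      then show ?thesis
        by (simp add: s_def threshold_rule_def algebra_simps)
    next
      case False
      then have "x c - w c \<le> 0"
        using x c w_eq_1 by (auto simp: responses_def)
      moreover have "M \<le> 1 / s c"
        using s_le[of c] s_pos[of c] c M_ge_1 by (simp add: field_simps)
      ultimately have "(x c - w c) * (1 / s c) \<le> (x c - w c) * M"
        by (intro mult_left_mono_neg)
      then show ?thesis
        by (simp add: diff_divide_distrib mult.commute)
    qed
  qed
  also have "\<dots> = M * (?I x - ?I w)"
    using int x w_response by simp
  finally have "?I (\<lambda>c. x c / s c) - ?I (\<lambda>c. w c / s c) \<le> M * (?I x - M / 2)"
    using int x w_response by (simp add: integral_w)
  \<comment> \<open>This square is the error of linearizing the squared mean at
    \<open>M / 2\<close>.\<close>
  moreover have "0 \<le> (?I x - M / 2)\<^sup>2"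
    by simp
  ultimately show ?thesis
    unfolding objective_def integral_w by (simp add: power2_eq_square algebra_simps)
qed

text \<open>The tangent bound is integrated: \<open>?d\<close> is the pointwise difference of
  Lagrangians, nonnegative by the bound. In the equality case its integral vanishes, hence so does
  the quadratic remainder almost everywhere.\<close>

lemma s_best_allocation:
  assumes A: "A \<in> feasible F (G F q)"
  shows "objective F s w \<le> objective F A w"
    and "objective F A w \<le> objective F s w \<Longrightarrow> AE c in F. A c = s c"
proof -
  let ?I = "\<lambda>f. LINT c:{0..1}|F. f c"
  let ?d = "\<lambda>c. w c / A c - w c / s c - M\<^sup>2 / q * (c * s c - c * A c)"
  have tangent: "w c * (A c - s c)\<^sup>2 / (A c * (s c)\<^sup>2) \<le> ?d c" if "c \<in> {0..1}" for c
    using allocation_tangent[of q c "A c" M t] that A t_bounds M_ge_1 q_pos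
    by (auto simp: feasible_def Pi_iff w_def s_def)
  have A_pos: "0 < A c" if "c \<in> {0..1}" for c
    using A that by (auto simp: feasible_def)
  have d_nonneg: "0 \<le> ?d c" if "c \<in> {0..1}" for c
  proof -
    have "0 \<le> w c" "0 < A c"
      using that w_bounds A_pos by auto
    then have "0 \<le> w c * (A c - s c)\<^sup>2 / (A c * (s c)\<^sup>2)"
      by simp
    then show ?thesis
      using tangent[OF that] by linarith
  qed
  note int = set_integrable_response_div[OF w_response A]
    set_integrable_response_div[OF w_response s_feasible]
    set_integrable_cost_allocation[OF A] set_integrable_cost_allocation[OF s_feasible]
  have d_int: "set_integrable F {0..1} ?d"
    by (intro set_integral_diff(1) set_integrable_mult_right int)
  \<comment> \<open>The squared mean of \<open>w\<close> is the same for both allocations and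
    cancels; what remains is the variance gap minus the multiplier times the unspent budget.\<close>
  have d_val: "?I ?d = objective F A w - objective F s w - M\<^sup>2 / q * (G F q - spending F A)"
    using int by (simp add: objective_def spending_def[symmetric] spending_s)
  have "0 \<le> ?I ?d"
    unfolding set_lebesgue_integral_def
    by (intro Bochner_Integration.integral_nonneg) (use d_nonneg in \<open>auto simp: indicator_def\<close>)
  moreover have "0 \<le> M\<^sup>2 / q * (G F q - spending F A)"
    using A q_pos by (auto simp: feasible_def)
  ultimately show "objective F s w \<le> objective F A w"
    using d_val by linarith
  assume "objective F A w \<le> objective F s w"
  then have "?I ?d = 0"
    using d_val \<open>0 \<le> ?I ?d\<close> \<open>0 \<le> M\<^sup>2 / q * (G F q - spending F A)\<close> by linarith
  then have "AE c in F. indicator {0..1} c *\<^sub>R ?d c = 0"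
    unfolding set_lebesgue_integral_def
  proof (rule iffD1[OF integral_nonneg_eq_0_iff_AE, rotated -1])
    show "AE c in F. 0 \<le> indicator {0..1} c *\<^sub>R ?d c"
      using d_nonneg by (intro AE_I2) (simp add: indicator_def)
  qed (use d_int in \<open>simp add: set_integrable_def\<close>)
  then show "AE c in F. A c = s c"
    using AE_cost
  proof eventually_elim
    case (elim c)
    then have c: "c \<in> {0..1}" and "?d c = 0" by auto
    then have "w c * (A c - s c)\<^sup>2 / (A c * (s c)\<^sup>2) \<le> 0"
      using tangent[OF c] by linarith
    moreover have "0 < w c" "0 < A c * (s c)\<^sup>2"
      using w_pos[of c] A_pos[OF c] s_pos[of c] elim by auto
    ultimately have "w c * (A c - s c)\<^sup>2 \<le> 0"
      by (simp only: divide_le_0_iff) linarith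
    then show ?case
      using \<open>0 < w c\<close> by (simp add: mult_le_0_iff)
  qed
qed

lemma worst_case_ge: "ereal (objective F A w) \<le> worst_case F A"
  unfolding worst_case_def by (rule SUP_upper) (rule w_response)

lemma worst_case_s: "worst_case F s = ereal (objective F s w)"
proof (rule antisym)
  show "worst_case F s \<le> ereal (objective F s w)"
    unfolding worst_case_def by (rule SUP_least) (simp add: w_best_response)
qed (rule worst_case_ge)

text \<open>Every feasible allocation must face \<open>w\<close> in particular, and against
  \<open>w\<close> none beats \<open>s\<close>.\<close>

lemma Inf_worst_case: "(INF A\<in>feasible F (G F q). worst_case F A) = ereal (objective F s w)"
proof (rule antisym)
  show "(INF A\<in>feasible F (G F q). worst_case F A) \<le> ereal (objective F s w)"
    using INF_lower[OF s_feasible, of "worst_case F"] by (simp add: worst_case_s)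
  show "ereal (objective F s w) \<le> (INF A\<in>feasible F (G F q). worst_case F A)"
  proof (rule INF_greatest)
    fix A assume "A \<in> feasible F (G F q)"
    then have "ereal (objective F s w) \<le> ereal (objective F A w)"
      using s_best_allocation(1) by simp
    then show "ereal (objective F s w) \<le> worst_case F A"
      using worst_case_ge order_trans by blast
  qed
qed

lemma optimal_s: "optimal_allocation F (G F q) s"
  by (simp add: optimal_allocation_def s_feasible Inf_worst_case worst_case_s)

text \<open>An optimal \<open>A\<close> does no worse against \<open>w\<close> than its worst case,
  which is the value of \<open>s\<close> against \<open>w\<close>; so the equality case
  applies.\<close>

lemma optimal_unique:
  assumes "optimal_allocation F (G F q) A"
  shows "AE c in F. A c = s c"
  using assms worst_case_ge[of A] s_best_allocation(2)[of A]
  by (simp add: optimal_allocation_def Inf_worst_case)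

end

section \<open>Independence of values outside the unit interval\<close>

lemma spending_cong:
  assumes "\<And>c. c \<in> {0..1} \<Longrightarrow> A c = A' c"
  shows "spending F A = spending F A'"
  unfolding spending_def set_lebesgue_integral_def
  by (intro Bochner_Integration.integral_cong refl) (auto simp: assms indicator_def)

lemma worst_case_cong:
  assumes "\<And>c. c \<in> {0..1} \<Longrightarrow> A c = A' c"
  shows "worst_case F A = worst_case F A'"
proof -
  have "(LINT c:{0..1}|F. x c / A c) = (LINT c:{0..1}|F. x c / A' c)" for x
    unfolding set_lebesgue_integral_def
    by (intro Bochner_Integration.integral_cong refl) (auto simp: assms indicator_def)
  then show ?thesis
    by (simp add: worst_case_def objective_def)
qed

lemma optimal_allocation_cong:
  assumes "\<And>c. c \<in> {0..1} \<Longrightarrow> A c = A' c"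
  shows "optimal_allocation F B A \<longleftrightarrow> optimal_allocation F B A'"
proof -
  have "A \<in> feasible F B \<longleftrightarrow> A' \<in> feasible F B"
    using assms spending_cong[of A A' F]
    by (simp add: feasible_def Pi_iff monotone_on_def)
  then show ?thesis
    using worst_case_cong[of A A' F] assms by (simp add: optimal_allocation_def)
qed

section \<open>The optimal threshold rule\<close>

lemma x_star_eq:
  assumes "\<exists>!x. 0 < x \<and> G F x = B" "0 < q" "G F q = B"
  shows "x_star F B = min 1 q"
proof -
  have "(THE x. 0 < x \<and> G F x = B) = q"
    using assms by (intro the1_equality) auto
  moreover have "\<not> (\<forall>x>0. G F x < B)"
    using assms by auto
  ultimately have "G_inv F B = ereal q"
    unfolding G_inv_def by simp
  then show ?thesis
    by (simp add: x_star_def one_ereal_def flip: ereal_min)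
qed

text \<open>The constant is \<open>1 / M\<close> with \<open>R_inf\<close> taken at the root
  \<open>q\<close>, which is \<open>xs\<close> only if \<open>q <= 1\<close>. If
  \<open>q > 1\<close>, then \<open>xs = 1\<close> and the level
  \<open>1 / max 1 (R_inf F 1)\<close> would spend only \<open>G F 1 < B\<close>; the binding budget
  gives \<open>B\<close> over the mean instead. If \<open>D = 0\<close>, almost no cost exceeds
  \<open>xs\<close>, so the budget cannot determine \<alpha>.\<close>

theorem theorem2:
  fixes F :: "real measure" and B :: real
  assumes "real_distribution F"
    and "atomless F"
    and "supported_in F {0<..1}"
    and "0 < B"
    and "B < (\<integral>c. c \<partial>F)"
  defines "xs \<equiv> x_star F B"
  defines "D \<equiv> (\<integral>c. sqrt c * indicator {xs<..} c \<partial>F)"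
  shows "(\<exists>!x. 0 < x \<and> G F x = B) \<and>
    (\<exists>Ab \<alpha>.
      optimal_allocation F B (threshold_rule Ab xs \<alpha>) \<and>
      (\<forall>A. optimal_allocation F B A \<longrightarrow> (AE c in F. A c = threshold_rule Ab xs \<alpha> c)) \<and>
      spending F (threshold_rule Ab xs \<alpha>) = B \<and>
      (D \<noteq> 0 \<longrightarrow>
        (\<forall>\<beta>. spending F (threshold_rule Ab xs \<beta>) = B \<longrightarrow> \<beta> = \<alpha>) \<and>
        \<alpha> = (B - Ab * (\<integral>c. c * indicator {..xs} c \<partial>F)) / D) \<and>
      (B \<le> G F 1 \<longrightarrow> Ab = 1 / max 1 (R_inf F xs)) \<and>
      (G F 1 < B \<longrightarrow> Ab = B / (\<integral>c. c \<partial>F)))"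
proof -
  interpret cost_distribution F
    by (intro cost_distribution.intro cost_distribution_axioms.intro assms(1,3))
  have ex1: "\<exists>!x. 0 < x \<and> G F x = B"
    by (rule ex1_G_eq[OF assms(4,5)])
  obtain q where q: "0 < q" and G_q: "G F q = B"
    using ex1_implies_ex[OF ex1] by (elim exE conjE)
  have "saddle F q"
    using q by (intro saddle.intro saddle_axioms.intro cost_distribution_axioms)
  then interpret saddle F q .
  have xs: "xs = min 1 q"
    unfolding xs_def by (rule x_star_eq[OF ex1 q G_q])
  \<comment> \<open>Replacing the cut \<open>q\<close> by \<open>xs = min 1 q\<close> changes the
    rule only at costs above 1.\<close>
  define A0 where "A0 = threshold_rule (1 / M) xs (sqrt q / M)"
  have A0_s: "A0 c = s c" if "c \<le> 1" for c
    using that by (simp add: A0_def s_def threshold_rule_def xs)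
  have optimal: "optimal_allocation F B A0"
    using optimal_s optimal_allocation_cong[of A0 s F B] A0_s by (simp add: G_q)
  have unique: "AE c in F. A c = A0 c" if "optimal_allocation F B A" for A
  proof -
    have "AE c in F. A c = s c"
      using that by (intro optimal_unique) (simp add: G_q)
    then show ?thesis
      using AE_cost by eventually_elim (simp add: A0_s)
  qed
  have spend: "spending F A0 = B"
    using spending_cong[of A0 s F] A0_s spending_s G_q by simp
  have spend_eq: "spending F (threshold_rule (1 / M) xs \<beta>)
      = 1 / M * (\<integral>c. c * indicator {..xs} c \<partial>F) + \<beta> * D" for \<beta>
    unfolding D_def using q by (intro spending_threshold_rule) (simp add: xs)
  have \<alpha>_eq: "\<beta> = (B - 1 / M * (\<integral>c. c * indicator {..xs} c \<partial>F)) / D"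
    if "D \<noteq> 0" "spending F (threshold_rule (1 / M) xs \<beta>) = B" for \<beta>
    using that unfolding spend_eq by (simp add: eq_divide_eq)
  have low: "1 / M = 1 / max 1 (R_inf F xs)" if "B \<le> G F 1"
  proof -
    have "\<not> 1 < q"
    proof
      assume "1 < q"
      then have "G F 1 < G F q"
        using G_mono[of 1 q] G_q assms(5) by (intro G_strict_mono) auto
      then show False
        using that G_q by simp
    qed
    then show ?thesis by (simp add: xs M_def)
  qed
  have high: "1 / M = B / (\<integral>c. c \<partial>F)" if "G F 1 < B"
  proof -
    have "1 < q"
      using G_mono[of q 1] q G_q that by linarith
    have "AE c in F. c \<le> q"
      using AE_cost by eventually_elim (use \<open>1 < q\<close> in simp)
    \<comment> \<open>With no cost above \<open>q\<close>, the numerator of \<open>G F q\<close> is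
      the mean, which yields \<open>M\<close> from the budget alone.\<close>
    then have "B = (\<integral>c. c \<partial>F) / M"
      using Q_eq_mean[OF q] G_q by (simp add: G_def M_def)
    then show ?thesis
      using assms(4,5) by simp
  qed
  show ?thesis
  proof (rule conjI[OF ex1], rule exI[of _ "1 / M"], rule exI[of _ "sqrt q / M"],
      fold A0_def, intro conjI impI allI)
    show "sqrt q / M = (B - 1 / M * (\<integral>c. c * indicator {..xs} c \<partial>F)) / D" if "D \<noteq> 0"
      by (rule \<alpha>_eq[OF that spend[unfolded A0_def]])
    show "\<beta> = sqrt q / M"
      if "D \<noteq> 0" "spending F (threshold_rule (1 / M) xs \<beta>) = B" for \<beta>
      using \<alpha>_eq[OF that] \<alpha>_eq[OF that(1) spend[unfolded A0_def]] by (rule trans[OF _ sym])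
  qed (use optimal unique spend low high in simp_all)
qed

end
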